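(* For each of the methods MIISO2, MIISO3, and MIISO4, the scalar amplification map $R$ (with any cutoff $\omega_c>0$) satisfies $|R(z)|\le 1$ for all $z\in\mathbb{C}$ with $\mathrm{Re}(z)\le 0$, independently of the step size $h>0$. Hence every member of the family is unconditionally $A$-stable for the linear test equation $y'=\lambda y$, on which the method acts by $y_{n+1}=R(h\lambda)\,y_n$.
   Context: Padé approximants. $[m/n]$ denotes the Padé approximant of $e^z$: the unique rational function $P_{m,n}/Q_{m,n}$ with $\deg P_{m,n}=m$, $\deg Q_{m,n}=n$, $Q_{m,n}(0)=1$ and $P_{m,n}/Q_{m,n}-e^z=O(z^{m+n+1})$ as $z\to0$. In particular $[1/1](z)=\frac{1+z/2}{1-z/2}$, $[2/2](z)=\frac{1+z/2+z^2/12}{1-z/2+z^2/12}$, $[0/N](z)=1/Q_N(z)$ with $Q_N(z)=\sum_{j=0}^N\frac{(-z)^j}{j!}$, $[1/2](z)=\frac{1+z/3}{1-2z/3+z^2/6}$, $[1/3](z)=\frac{1+z/4}{1-3z/4+z^2/4-z^3/24}$. Repaired dissipative map. For $N\in\{3,4\}$ let $\mathcal{W}_N=\{z:\mathrm{Re}(z)\le0,\ |Q_N(z)|<1\}$, $R_{\mathrm{raw}}=[0/N]$, $R_{\mathrm{fix}}=[1/(N-1)]$, $\delta=0.10$, and $\omega_*=\sqrt3$ if $N=3$, $\omega_*=\sqrt8$ if $N=4$. For $0<|y|<\omega_*$ let $x_b(y)<0$ be the unique negative root $x$ of $|Q_N(x+iy)|=1$. The weight $\theta_{\mathrm{wedge}}$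 takes values in $[0,1]$; it equals $1$ on $\mathcal{W}_N$ and at the origin; it lies strictly between $0$ and $1$ in a transition pad around $\mathcal{W}_N$, whose outer edge is $\mathrm{Re}(z)=(1+\delta)x_b(\mathrm{Im}(z))$ or $|\mathrm{Im}(z)|=(1+\delta)\omega_*$, decreasing linearly from the inner to the outer edge; and it equals $0$ outside the wedge and the pad (in particular for all large $|z|$). On $\{\mathrm{Re}(z)\le 0\}$ it equals $0$ only where $|[0/N](z)|\le1$, and is strictly between $0$ and $1$ only where both $|R_{\mathrm{raw}}(z)|\le1$ and $|R_{\mathrm{fix}}(z)|\le1$. With $\theta=\theta_{\mathrm{wedge}}(z)$ the repaired map is $$R_D(z)=|R_{\mathrm{fix}}(z)|^{\theta}|R_{\mathrm{raw}}(z)|^{1-\theta}\exp\bigl(i[(1-\theta)\arg R_{\mathrm{raw}}(z)+\theta\arg R_{\mathrm{fix}}(z)]\bigr),$$ with continuous branches of $\arg$ vanishing at $z=0$; so $R_D=R_{\mathrm{fix}}$ where $\theta=1$ and $R_D=R_{\mathrm{raw}}$ where $\theta=0$. Amplification map. The parents are: MIISO2: $R_C=[1/1]$, $R_D=[0/2]$ (no repair); MIISO3: $R_C=[2/2]$, $R_D$ the repaired map with $N=3$; MIISO4: $R_C=[2/2]$, $R_D$ the repaired map with $N=4$. Given a cutoff $\omega_c>0$ (taken as the modulus of the $k$-th largest-magnitude eigenvalue of $hJ$, $J$ the Jacobian and $k$ the prescribed outlier count, or prescribed by the user), fix $r\in(0,1)$ and an integer $s>1$ (defaults $r=0.99$,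 $s=4$), put $\omega_0=r\omega_c$, and define the taper $\theta(\omega)=0$ for $\omega\le\omega_0$, $\theta(\omega)=\bigl(\frac{\omega-\omega_0}{\omega_c-\omega_0}\bigr)^s$ for $\omega_0<\omega<\omega_c$, $\theta(\omega)=1$ for $\omega\ge\omega_c$. The amplification map is $$R(z)=|R_D(z)|^{\theta(|z|)}|R_C(z)|^{1-\theta(|z|)}\exp\bigl(i[(1-\theta(|z|))\arg R_C(z)+\theta(|z|)\arg R_D(z)]\bigr),$$ with continuous branches of $\arg$ vanishing at $0$; $R=R_C$ where $\theta=0$ and $R=R_D$ where $\theta=1$. A one-step method advancing $y'=\lambda y$ by $y_{n+1}=R(h\lambda)y_n$ is $A$-stable if $|R(z)|\le1$ whenever $\mathrm{Re}(z)\le0$. *)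

theory Defs
  imports
    "HOL-Analysis.Analysis"
    "HOL-Computational_Algebra.Polynomial"
    "HOL-Library.Landau_Symbols"
begin

section \<open>Pad\'e approximants of the exponential\<close>

definition is_pade :: "nat \<Rightarrow> nat \<Rightarrow> complex poly \<Rightarrow> complex poly \<Rightarrow> bool" where
  "is_pade m n P Q \<longleftrightarrow>
     degree P = m \<and> degree Q = n \<and> poly Q 0 = 1 \<and>
     (\<lambda>z. poly P z / poly Q z - exp z) \<in> O[at 0](\<lambda>z. z ^ (m + n + 1))"

text \<open>At a pole the value is \<open>0\<close>, by the convention \<open>x / 0 = 0\<close>. In the closed left
  half-plane the approximants used below have no poles.\<close>

definition pade :: "nat \<Rightarrow> nat \<Rightarrow> complex \<Rightarrow> complex" where
  "pade m n z = (let PQ = (THE PQ. is_pade m n (fst PQ) (snd PQ))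
                 in poly (fst PQ) z / poly (snd PQ) z)"


section \<open>Geometric blending and branches of the argument\<close>

text \<open>The two limiting cases are separated because \<open>0 powr 0 = 0\<close> in HOL: where one of the
  two values is \<open>0\<close>, the formula alone would not give back the other one for weight \<open>1\<close>.\<close>

definition geom_blend ::
  "real \<Rightarrow> complex \<Rightarrow> real \<Rightarrow> complex \<Rightarrow> real \<Rightarrow> complex" where
  "geom_blend t a \<alpha> b \<beta> =
     (if t = 0 then a
      else if t = 1 then b
      else of_real (norm b powr t * norm a powr (1 - t)) * cis ((1 - t) * \<alpha> + t * \<beta>))"

text \<open>\<open>a\<close> is a continuous branch of \<open>arg f\<close> vanishing at the origin. The approximants have
  zeros and poles, so no branch is continuous on all of the plane. Branch cuts are allowed: a
  closed set with empty interior that avoids the origin. On the cuts \<open>a\<close> is still some value of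
  the argument, and at zeros of \<open>f\<close> (and at poles, where \<open>f\<close> is \<open>0\<close> by convention) it is
  arbitrary.\<close>

definition arg_branch :: "(complex \<Rightarrow> complex) \<Rightarrow> (complex \<Rightarrow> real) \<Rightarrow> bool" where
  "arg_branch f a \<longleftrightarrow>
     a 0 = 0 \<and>
     (\<forall>z. f z \<noteq> 0 \<longrightarrow> f z = of_real (norm (f z)) * cis (a z)) \<and>
     (\<exists>cuts. closed cuts \<and> interior cuts = {} \<and> 0 \<notin> cuts \<and> continuous_on (- cuts) a)"


section \<open>The repaired dissipative map\<close>

definition Q_exp :: "nat \<Rightarrow> complex \<Rightarrow> complex" where
  "Q_exp N z = (\<Sum>j\<le>N. (- z) ^ j / fact j)"

definition wedge :: "nat \<Rightarrow> complex set" where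
  "wedge N = {z. Re z \<le> 0 \<and> norm (Q_exp N z) < 1}"

text \<open>\<open>omega_star\<close>, and with it \<open>wedge_weight\<close>, is only meant for \<open>N \<in> {3, 4}\<close>.\<close>

definition omega_star :: "nat \<Rightarrow> real" where
  "omega_star N = (if N = 3 then sqrt 3 else sqrt 8)"

definition pad_delta :: real where
  "pad_delta = 1 / 10"

definition x_b :: "nat \<Rightarrow> real \<Rightarrow> real" where
  "x_b N y = (THE x. x < 0 \<and> norm (Q_exp N (Complex x y)) = 1)"

text \<open>The weight is given by its properties, with \<open>pad\<close> the transition pad. For
  \<open>0 < \<bar>y\<bar> < omega_star N\<close> the pad and the weight are determined in the left half-plane: linear
  from \<open>1\<close> at the inner edge \<open>x_b N y\<close> to \<open>0\<close> at the outer edge. In the strips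
  \<open>omega_star N \<le> \<bar>y\<bar> < (1 + pad_delta) * omega_star N\<close> only the outer edge is prescribed;
  there the weight is linear in \<open>\<bar>y\<bar>\<close> on vertical lines and vanishes at the outer edge, the
  slope \<open>k\<close> and the horizontal extent of the pad being left open. In the right half-plane the
  pad is only required to be bounded and to stay below the outer edge.

  For such a weight, \<open>\<theta> z = 0\<close> with \<open>Re z \<le> 0\<close> forces \<open>z \<notin> wedge N\<close>, that is
  \<open>norm (pade 0 N z) \<le> 1\<close>, and likewise for \<open>0 < \<theta> z < 1\<close>; so these bounds
  are not listed. Neither is the bound on \<open>norm (pade 1 (N - 1) z)\<close>, which holds in all of
  the closed left half-plane.\<close>

definition wedge_weight :: "nat \<Rightarrow> (complex \<Rightarrow> real) \<Rightarrow> bool" where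
  "wedge_weight N \<theta> \<longleftrightarrow>
     (\<forall>z. 0 \<le> \<theta> z \<and> \<theta> z \<le> 1) \<and>
     \<theta> 0 = 1 \<and>
     (\<forall>z\<in>wedge N. \<theta> z = 1) \<and>
     (\<exists>pad k.
        bounded pad \<and>
        (\<forall>z\<in>pad. 0 < \<theta> z \<and> \<theta> z < 1 \<and> \<bar>Im z\<bar> < (1 + pad_delta) * omega_star N) \<and>
        (\<forall>z. z \<notin> wedge N \<union> closure pad \<union> {0} \<longrightarrow> \<theta> z = 0) \<and>
        (\<forall>z. \<bar>Im z\<bar> \<ge> (1 + pad_delta) * omega_star N \<longrightarrow> \<theta> z = 0) \<and>
        (\<forall>x y. x \<le> 0 \<and> 0 < \<bar>y\<bar> \<and> \<bar>y\<bar> < omega_star N \<longrightarrow>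
           (Complex x y \<in> pad \<longleftrightarrow> (1 + pad_delta) * x_b N y < x \<and> x < x_b N y) \<and>
           ((1 + pad_delta) * x_b N y \<le> x \<and> x \<le> x_b N y \<longrightarrow>
              \<theta> (Complex x y) =
                (x - (1 + pad_delta) * x_b N y) / (x_b N y - (1 + pad_delta) * x_b N y))) \<and>
        (\<forall>x\<le>0. Complex x 0 \<notin> pad) \<and>
        (\<forall>y. omega_star N < \<bar>y\<bar> \<and> \<bar>y\<bar> < (1 + pad_delta) * omega_star N \<longrightarrow> Complex 0 y \<in> pad) \<and>
        (\<forall>z\<in>pad. Re z \<le> 0 \<and> omega_star N \<le> \<bar>Im z\<bar> \<longrightarrow>
           \<theta> z = k (Re z) * ((1 + pad_delta) * omega_star N - \<bar>Im z\<bar>)))"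

text \<open>The second component is the argument of the repaired map. It is the exponent in the
  definition of that map; being a blend of two branches, it vanishes at the origin and is an
  argument of the map wherever the latter is nonzero.\<close>

definition repaired_map ::
  "nat \<Rightarrow> (complex \<Rightarrow> complex) \<Rightarrow> (complex \<Rightarrow> real) \<Rightarrow> bool" where
  "repaired_map N R_D arg_D \<longleftrightarrow>
     (\<exists>\<theta> arg_raw arg_fix.
        wedge_weight N \<theta> \<and>
        arg_branch (pade 0 N) arg_raw \<and>
        arg_branch (pade 1 (N - 1)) arg_fix \<and>
        R_D = (\<lambda>z. geom_blend (\<theta> z) (pade 0 N z) (arg_raw z) (pade 1 (N - 1) z) (arg_fix z)) \<and>
        arg_D = (\<lambda>z. (1 - \<theta> z) * arg_raw z + \<theta> z * arg_fix z))"


section \<open>The MIISO methods\<close>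

datatype miiso = MIISO2 | MIISO3 | MIISO4

fun conservative_parent :: "miiso \<Rightarrow> complex \<Rightarrow> complex" where
  "conservative_parent MIISO2 = pade 1 1"
| "conservative_parent MIISO3 = pade 2 2"
| "conservative_parent MIISO4 = pade 2 2"

fun dissipative_parent ::
  "miiso \<Rightarrow> (complex \<Rightarrow> complex) \<Rightarrow> (complex \<Rightarrow> real) \<Rightarrow> bool" where
  "dissipative_parent MIISO2 R_D arg_D \<longleftrightarrow> R_D = pade 0 2 \<and> arg_branch (pade 0 2) arg_D"
| "dissipative_parent MIISO3 R_D arg_D \<longleftrightarrow> repaired_map 3 R_D arg_D"
| "dissipative_parent MIISO4 R_D arg_D \<longleftrightarrow> repaired_map 4 R_D arg_D"

definition taper :: "real \<Rightarrow> real \<Rightarrow> nat \<Rightarrow> real \<Rightarrow> real" where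
  "taper \<omega>\<^sub>c r s \<omega> =
     (let \<omega>\<^sub>0 = r * \<omega>\<^sub>c in
      if \<omega> \<le> \<omega>\<^sub>0 then 0
      else if \<omega> < \<omega>\<^sub>c then ((\<omega> - \<omega>\<^sub>0) / (\<omega>\<^sub>c - \<omega>\<^sub>0)) ^ s
      else 1)"

text \<open>A predicate rather than a function: \<open>R\<close> is an amplification map of the method for some
  admissible choice of the branches of the argument and of the weight.\<close>

definition amplification_map ::
  "miiso \<Rightarrow> real \<Rightarrow> real \<Rightarrow> nat \<Rightarrow> (complex \<Rightarrow> complex) \<Rightarrow> bool" where
  "amplification_map M \<omega>\<^sub>c r s R \<longleftrightarrow>
     (\<exists>arg_C R_D arg_D.
        arg_branch (conservative_parent M) arg_C \<and>
        dissipative_parent M R_D arg_D \<and>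
        R = (\<lambda>z. geom_blend (taper \<omega>\<^sub>c r s (norm z))
                   (conservative_parent M z) (arg_C z) (R_D z) (arg_D z)))"

text \<open>A-stability of the one-step method \<open>y (n+1) = R (h * \<lambda>) * y n\<close>.\<close>

definition A_stable :: "(complex \<Rightarrow> complex) \<Rightarrow> bool" where
  "A_stable R \<longleftrightarrow> (\<forall>z. Re z \<le> 0 \<longrightarrow> norm (R z) \<le> 1)"

end

theory Submission
  imports Defs
begin

text \<open>The blend of two numbers of modulus at most one has modulus at most one, and in the left
  half-plane the weight of the wedge is \<open>1\<close> wherever \<open>[0/N]\<close> has modulus greater than one. It
  remains to bound \<open>[1/1]\<close>, \<open>[2/2]\<close>, \<open>[0/2]\<close>, \<open>[1/2]\<close> and \<open>[1/3]\<close> there: for each of these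
  quotients \<open>P / Q\<close> and \<open>z = - u + i y\<close>, the polynomial \<open>\<bar>Q\<bar>\<^sup>2 - \<bar>P\<bar>\<^sup>2\<close> in \<open>u\<close> and \<open>y\<^sup>2\<close> has
  nonnegative coefficients. The explicit form of the approximants follows from uniqueness: two
  Pad\'e pairs cross-multiply to equal polynomials, and a Bezout identity for one of them makes
  them equal.\<close>

section \<open>Pad\'e approximants\<close>

lemma poly_in_bigo_const: "poly p \<in> O[at (0::complex)](\<lambda>_. 1)"
  using tendsto_poly[OF tendsto_ident_at, of p 0 UNIV]
  by (intro bigoI_tendsto[where c = "poly p 0"]) simp_all

text \<open>Induction on \<open>k\<close>: the bound forces the constant coefficient to vanish, and
  dividing by \<open>z\<close> lowers order and degree together.\<close>

lemma poly_eq_0_if_bigo_power: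
  fixes p :: "complex poly"
  assumes "poly p \<in> O[at 0](\<lambda>z. z ^ k)" and "degree p < k"
  shows "p = 0"
  using assms
proof (induction k arbitrary: p)
  case 0
  from 0(2) show ?case by simp
next
  case (Suc k)
  obtain a q where p: "p = pCons a q" by (cases p)
  obtain c where c: "c > 0" "\<forall>\<^sub>F z in at 0. norm (poly p z) \<le> c * norm (z ^ Suc k :: complex)"
    using landau_o.bigE[OF Suc.prems(1)] by blast
  have "(poly p \<longlongrightarrow> 0) (at 0)"
  proof (rule Lim_null_comparison[OF c(2)])
    have "isCont (\<lambda>z::complex. c * norm (z ^ Suc k)) 0" by (intro continuous_intros)
    then show "((\<lambda>z::complex. c * norm (z ^ Suc k)) \<longlongrightarrow> 0) (at 0)"
      by (simp add: isCont_def)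
  qed
  moreover have "(poly p \<longlongrightarrow> poly p 0) (at 0)"
    by (intro tendsto_poly tendsto_ident_at)
  ultimately have "poly p 0 = 0"
    using tendsto_unique[OF at_neq_bot] by blast
  then have a: "a = 0" by (simp add: p)
  \<comment> \<open>The filter \<open>at 0\<close> excludes the origin, so a factor
    \<open>norm z\<close> cancels.\<close>
  have "\<forall>\<^sub>F z in at 0. norm (poly q z) \<le> c * norm (z ^ k)"
    using c(2) eventually_at_ball'[OF zero_less_one, of "0::complex" UNIV]
  proof (eventually_elim)
    case (elim z)
    then have "norm z * norm (poly q z) \<le> norm z * (c * norm (z ^ k))"
      by (simp add: p a norm_mult algebra_simps)
    then show ?case using elim by simp
  qed
  then have q: "poly q \<in> O[at 0](\<lambda>z. z ^ k)" by (rule bigoI)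
  \<comment> \<open>The degree drops by one only for \<open>q \<noteq> 0\<close>.\<close>
  show ?case
  proof (cases "q = 0")
    case True
    then show ?thesis by (simp add: p a)
  next
    case False
    then have "degree q < k" using Suc.prems(2) by (simp add: p)
    then show ?thesis using Suc.IH[OF q] False by simp
  qed
qed

lemma eventually_poly_nonzero:
  fixes Q :: "complex poly"
  assumes "poly Q 0 = 1"
  shows "\<forall>\<^sub>F z in at 0. poly Q z \<noteq> 0"
  using tendsto_imp_eventually_ne[OF tendsto_poly[OF tendsto_ident_at], of Q 0 0 UNIV] assms
  by simp

text \<open>Subtracting the two error terms cancels \<open>exp\<close>; clearing denominators leaves
  a polynomial of degree at most \<open>m + n\<close> but of order at least
  \<open>m + n + 1\<close>, hence zero.\<close>

lemma pade_cross_mult: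
  assumes "is_pade m n P Q" and "is_pade m n P' Q'"
  shows "P * Q' = P' * Q"
proof -
  let ?g = "\<lambda>z::complex. z ^ (m + n + 1)"
  have Q: "poly Q 0 = 1" "poly Q' 0 = 1" using assms by (auto simp: is_pade_def)
  have "(\<lambda>z. (poly P z / poly Q z - exp z) - (poly P' z / poly Q' z - exp z)) \<in> O[at 0](?g)"
    by (rule sum_in_bigo) (use assms in \<open>auto simp: is_pade_def\<close>)
  from landau_o.big.mult[OF poly_in_bigo_const[of "Q * Q'"] this]
  have "(\<lambda>z. poly (Q * Q') z * ((poly P z / poly Q z - exp z) - (poly P' z / poly Q' z - exp z)))
          \<in> O[at 0](?g)" by simp
  also have "?this \<longleftrightarrow> poly (P * Q' - P' * Q) \<in> O[at 0](?g)"
  proof (rule landau_o.big.in_cong)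
    show "\<forall>\<^sub>F z in at 0. poly (Q * Q') z *
        ((poly P z / poly Q z - exp z) - (poly P' z / poly Q' z - exp z)) =
        poly (P * Q' - P' * Q) z"
      using eventually_poly_nonzero[OF Q(1)] eventually_poly_nonzero[OF Q(2)]
      by eventually_elim (simp add: field_simps)
  qed
  finally have "poly (P * Q' - P' * Q) \<in> O[at 0](?g)" .
  moreover have "degree (P * Q' - P' * Q) < m + n + 1"
  proof -
    have "degree (P * Q') \<le> m + n" "degree (P' * Q) \<le> m + n"
      using assms degree_mult_le[of P Q'] degree_mult_le[of P' Q] by (auto simp: is_pade_def)
    then show ?thesis using degree_diff_le[of "P * Q'" "m + n" "P' * Q"] by simp
  qed
  ultimately have "P * Q' - P' * Q = 0" by (rule poly_eq_0_if_bigo_power)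
  then show ?thesis by simp
qed

text \<open>The Bezout identity makes \<open>Q\<close> divide \<open>Q'\<close>. Equal degrees make
  the cofactor \<open>K\<close> constant, and the normalization at \<open>0\<close> makes it
  \<open>1\<close>.\<close>

lemma pade_unique:
  assumes pade: "is_pade m n P Q" "is_pade m n P' Q'" and bezout: "A * P + B * Q = 1"
  shows "P' = P" and "Q' = Q"
proof -
  have eq: "P * Q' = P' * Q" using pade by (rule pade_cross_mult)
  define K where "K = A * P' + B * Q'"
  have "Q' = (A * P + B * Q) * Q'" by (simp add: bezout)
  also have "\<dots> = A * (P * Q') + B * Q * Q'" by (simp add: algebra_simps)
  also have "\<dots> = Q * K" unfolding eq K_def by (simp add: algebra_simps)
  finally have K: "Q' = Q * K" .
  have 0: "poly Q 0 = 1" "poly Q' 0 = 1" using pade by (auto simp: is_pade_def)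
  then have "Q \<noteq> 0" "Q' \<noteq> 0" by auto
  then have "degree Q' = degree Q + degree K"
    by (metis K degree_mult_eq mult_zero_right)
  then have "degree K = 0" using pade by (simp add: is_pade_def)
  then obtain c where "K = [:c:]" using degree_eq_zeroE by blast
  with K 0 have "K = 1" by (simp add: one_pCons)
  then show Q': "Q' = Q" by (simp add: K)
  then show "P' = P" using eq \<open>Q \<noteq> 0\<close> by simp
qed

section \<open>From a Taylor identity to the value of \<open>pade\<close>\<close>

lemma exp_minus_Q_exp_bigo: "(\<lambda>z. exp (- z) - Q_exp k z) \<in> O[at 0](\<lambda>z. z ^ Suc k)"
proof (rule bigoI[where c = "exp 1 / fact k"])
  show "\<forall>\<^sub>F z in at 0. norm (exp (- z) - Q_exp k z) \<le> exp 1 / fact k * norm (z ^ Suc k)"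
    using eventually_at_ball'[OF zero_less_one, of "0::complex" UNIV]
  proof eventually_elim
    case (elim z)
    have "norm (exp (- z) - Q_exp k z) \<le> exp (norm z) * norm z ^ Suc k / fact k"
      using Taylor_exp_field[of "- z" k] by (simp add: Q_exp_def)
    also have "\<dots> \<le> exp 1 * norm z ^ Suc k / fact k"
      using elim by (intro divide_right_mono mult_right_mono) auto
    finally show ?case by (simp add: norm_power norm_mult)
  qed
qed

text \<open>The condition on \<open>P\<close> and \<open>Q\<close> is the Pad\'e condition in the form
  \<open>P exp (- z) - Q = O(z ^ (m + n + 1))\<close>, with the exponential replaced by its Taylor
  polynomial.\<close>

lemma pade_eqI:
  fixes P Q S A B :: "complex poly"
  assumes "degree P = m" and "degree Q = n" and Q0: "poly Q 0 = 1"
    and taylor: "\<And>z. poly P z * Q_exp (m + n) z - poly Q z = z ^ (m + n + 1) * poly S z"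
    and bezout: "\<And>z. poly A z * poly P z + poly B z * poly Q z = 1"
  shows "pade m n z = poly P z / poly Q z"
proof -
  let ?g = "\<lambda>z::complex. z ^ (m + n + 1)"
  \<comment> \<open>This bounded factor turns \<open>P exp (- z) - Q\<close> into
    \<open>P / Q - exp z\<close> without changing the order.\<close>
  have inv: "(\<lambda>z. exp z / poly Q z) \<in> O[at 0](\<lambda>_. 1)"
    using tendsto_divide[OF tendsto_exp[OF tendsto_ident_at]
        tendsto_poly[OF tendsto_ident_at, of Q 0 UNIV]] Q0
    by (intro bigoI_tendsto[where c = 1]) simp_all
  have "(\<lambda>z. poly P z * (exp (- z) - Q_exp (m + n) z)) \<in> O[at 0](?g)"
    using landau_o.big.mult[OF poly_in_bigo_const[of P] exp_minus_Q_exp_bigo[of "m + n"]] by simp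
  moreover have "(\<lambda>z. poly S z * z ^ (m + n + 1)) \<in> O[at 0](?g)"
    using landau_o.big.mult[OF poly_in_bigo_const[of S] landau_o.big_refl[of ?g]] by simp
  ultimately have "(\<lambda>z. poly P z * (exp (- z) - Q_exp (m + n) z) + poly S z * z ^ (m + n + 1))
      \<in> O[at 0](?g)" by (rule sum_in_bigo)
  from landau_o.big.mult[OF inv this]
  have "(\<lambda>z. exp z / poly Q z *
      (poly P z * (exp (- z) - Q_exp (m + n) z) + poly S z * z ^ (m + n + 1))) \<in> O[at 0](?g)"
    by simp
  also have "?this \<longleftrightarrow> (\<lambda>z. poly P z / poly Q z - exp z) \<in> O[at 0](?g)"
  proof (rule landau_o.big.in_cong)
    show "\<forall>\<^sub>F z in at 0. exp z / poly Q z *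
        (poly P z * (exp (- z) - Q_exp (m + n) z) + poly S z * z ^ (m + n + 1)) =
        poly P z / poly Q z - exp z"
      using eventually_poly_nonzero[OF Q0]
    proof eventually_elim
      case (elim z)
      have "poly P z * (exp (- z) - Q_exp (m + n) z) + poly S z * z ^ (m + n + 1) =
          poly P z * exp (- z) - poly Q z"
        using taylor[of z] by (simp add: algebra_simps)
      then show ?case
        by (simp only:) (use elim in \<open>simp add: exp_minus field_simps\<close>)
    qed
  qed
  finally have pade: "is_pade m n P Q" using assms by (simp add: is_pade_def)
  have "A * P + B * Q = 1"
    using bezout by (intro poly_eq_poly_eq_iff[THEN iffD1] ext) simp
  note unique = pade_unique[OF pade _ this]
  have "(THE PQ. is_pade m n (fst PQ) (snd PQ)) = (P, Q)"
  proof (rule the_equality)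
    show "PQ = (P, Q)" if "is_pade m n (fst PQ) (snd PQ)" for PQ
      using unique[OF that] by (simp add: prod_eq_iff)
  qed (simp add: pade)
  then show ?thesis by (simp add: pade_def)
qed

section \<open>Explicit forms of the approximants\<close>

lemma pade_0: "pade 0 N z = 1 / Q_exp N z"
proof -
  define Q :: "complex poly" where "Q = (\<Sum>j\<le>N. monom ((- 1) ^ j / fact j) j)"
  have Q: "poly Q z = Q_exp N z" for z
    by (simp add: Q_def Q_exp_def poly_sum poly_monom power_minus[of z])
  have "coeff Q j = (if j \<le> N then (- 1) ^ j / fact j else 0)" for j
    by (simp add: Q_def coeff_sum if_distrib cong: if_cong)
  then have "degree Q = N"
    by (intro antisym degree_le le_degree) auto
  moreover have "Q_exp N 0 = 1"
    by (simp add: Q_exp_def sum.atMost_shift)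
  \<comment> \<open>\<open>Q\<close> is itself the Taylor polynomial, so the remainder is
    \<open>S = 0\<close>; the numerator \<open>1\<close> gives the Bezout pair
    \<open>1, 0\<close>.\<close>
  ultimately show ?thesis
    using pade_eqI[of 1 0 Q N 0 1 0 z] by (simp add: Q)
qed

lemma pade_1_1: "pade 1 1 z = (1 + z / 2) / (1 - z / 2)"
  \<comment> \<open>The last three polynomials are the remainder cofactor \<open>S\<close> and the
    Bezout cofactors of numerator and denominator; likewise in the next three lemmas.\<close>
  using pade_eqI[of "[:1, 1/2:]" 1 "[:1, -1/2:]" 1 "[:1/4:]" "[:1/2:]" "[:1/2:]" z]
  by (simp add: Q_exp_def atMost_nat_numeral fact_numeral power_numeral_reduce field_simps)

lemma pade_2_2: "pade 2 2 z = (1 + z / 2 + z\<^sup>2 / 12) / (1 - z / 2 + z\<^sup>2 / 12)"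
  using pade_eqI[of "[:1, 1/2, 1/12:]" 2 "[:1, -1/2, 1/12:]" 2 "[:1/144, 1/288:]"
      "[:1/2, -1/12:]" "[:1/2, 1/12:]" z]
  by (simp add: Q_exp_def atMost_nat_numeral fact_numeral power_numeral_reduce field_simps)

lemma pade_1_2: "pade 1 2 z = (1 + z / 3) / (1 - 2 * z / 3 + z\<^sup>2 / 6)"
  using pade_eqI[of "[:1, 1/3:]" 1 "[:1, -2/3, 1/6:]" 2 "[:-1/18:]" "[:7/9, -1/9:]" "[:2/9:]" z]
  by (simp add: Q_exp_def atMost_nat_numeral fact_numeral power_numeral_reduce field_simps)

lemma pade_1_3: "pade 1 3 z = (1 + z / 4) / (1 - 3 * z / 4 + z\<^sup>2 / 4 - z ^ 3 / 24)"
  using pade_eqI[of "[:1, 1/4:]" 1 "[:1, -3/4, 1/4, -1/24:]" 3 "[:1/96:]"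
      "[:29/32, -5/32, 1/64:]" "[:3/32:]" z]
  by (simp add: Q_exp_def atMost_nat_numeral fact_numeral power_numeral_reduce field_simps)


section \<open>Bounds in the left half-plane\<close>

text \<open>Here \<open>d\<close> is the expanded form of the difference of squared moduli, from
  which its sign can be read off. If \<open>b = 0\<close>, the quotient is \<open>0\<close> by
  convention.\<close>

lemma norm_divide_le_1I:
  fixes a b :: complex
  assumes "(Re b)\<^sup>2 + (Im b)\<^sup>2 - ((Re a)\<^sup>2 + (Im a)\<^sup>2) = d" and "d \<ge> 0"
  shows "norm (a / b) \<le> 1"
proof -
  have "(norm a)\<^sup>2 \<le> (norm b)\<^sup>2" using assms by (simp add: cmod_power2)
  then have "norm a \<le> norm b" by (rule power2_le_imp_le) simp
  then show ?thesis by (simp add: norm_divide divide_le_eq_1)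
qed

lemma left_half_plane_cases:
  assumes "Re z \<le> 0"
  obtains u y where "z = Complex (- u) y" and "u \<ge> 0"
  using that[of "- Re z" "Im z"] assms by (simp add: complex_eq_iff)

lemma norm_pade_1_1_le_1:
  assumes "Re z \<le> 0"
  shows "norm (pade 1 1 z) \<le> 1"
  unfolding pade_1_1
proof (rule norm_divide_le_1I)
  show "(Re (1 - z / 2))\<^sup>2 + (Im (1 - z / 2))\<^sup>2 - ((Re (1 + z / 2))\<^sup>2 + (Im (1 + z / 2))\<^sup>2)
      = 2 * (- Re z)"
    by (simp add: power2_eq_square field_simps)
qed (use assms in simp)

lemma norm_pade_2_2_le_1:
  assumes "Re z \<le> 0"
  shows "norm (pade 2 2 z) \<le> 1"
proof -
  obtain u y where z: "z = Complex (- u) y" and u: "u \<ge> 0"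
    using assms by (rule left_half_plane_cases)
  show ?thesis unfolding pade_2_2 z
    \<comment> \<open>Every term has a factor \<open>u\<close>: on the imaginary axis
      \<open>[2/2]\<close> has modulus exactly \<open>1\<close>.\<close>
    by (rule norm_divide_le_1I[where d = "2 * u + u * (u\<^sup>2 + y\<^sup>2) / 6"])
       (simp add: power2_eq_square field_simps,
        use u in \<open>intro add_nonneg_nonneg; simp\<close>)
qed

lemma norm_pade_0_2_le_1:
  assumes "Re z \<le> 0"
  shows "norm (pade 0 2 z) \<le> 1"
proof -
  obtain u y where z: "z = Complex (- u) y" and u: "u \<ge> 0"
    using assms by (rule left_half_plane_cases)
  show ?thesis unfolding pade_0 z
    by (rule norm_divide_le_1I[where d = "2 * u + 2 * u\<^sup>2 + u ^ 3 + u ^ 4 / 4 + u * y\<^sup>2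
          + u\<^sup>2 * y\<^sup>2 / 2 + y ^ 4 / 4"])
       (simp add: Q_exp_def atMost_nat_numeral fact_numeral power_numeral_reduce
          field_simps,
        use u in \<open>intro add_nonneg_nonneg; simp\<close>)
qed

lemma norm_pade_1_2_le_1:
  assumes "Re z \<le> 0"
  shows "norm (pade 1 2 z) \<le> 1"
proof -
  obtain u y where z: "z = Complex (- u) y" and u: "u \<ge> 0"
    using assms by (rule left_half_plane_cases)
  show ?thesis unfolding pade_1_2 z
    \<comment> \<open>At \<open>u = 0\<close> the term \<open>y ^ 4 / 36\<close> remains, so the
      imaginary axis is damped away from the origin.\<close>
    by (rule norm_divide_le_1I[where d = "2 * u + 2/3 * u\<^sup>2 + 2/9 * u ^ 3 + u ^ 4 / 36
          + 2/9 * u * y\<^sup>2 + u\<^sup>2 * y\<^sup>2 / 18 + y ^ 4 / 36"])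
       (simp add: power_numeral_reduce field_simps,
        use u in \<open>intro add_nonneg_nonneg; simp\<close>)
qed

lemma norm_pade_1_3_le_1:
  assumes "Re z \<le> 0"
  shows "norm (pade 1 3 z) \<le> 1"
proof -
  obtain u y where z: "z = Complex (- u) y" and u: "u \<ge> 0"
    using assms by (rule left_half_plane_cases)
  show ?thesis unfolding pade_1_3 z
    by (rule norm_divide_le_1I[where d = "2 * u + u\<^sup>2 + 11/24 * u ^ 3 + u ^ 4 / 8 + u ^ 5 / 48
          + u ^ 6 / 576 + u * y\<^sup>2 / 8 + u\<^sup>2 * y\<^sup>2 / 8 + u ^ 3 * y\<^sup>2 / 24 + u ^ 4 * y\<^sup>2 / 192
          + u * y ^ 4 / 48 + u\<^sup>2 * y ^ 4 / 192 + y ^ 6 / 576"])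
       (simp add: power_numeral_reduce field_simps,
        use u in \<open>intro add_nonneg_nonneg; simp\<close>)
qed


section \<open>Blending and stability\<close>

text \<open>The phase has modulus \<open>1\<close>, so only the powers of the moduli count. At
  weights \<open>0\<close> and \<open>1\<close> a single operand is returned, and the other may be
  large; this is what the wedge requires.\<close>

lemma norm_geom_blend_le_1:
  assumes "0 \<le> t" "t \<le> 1" and "t \<noteq> 1 \<Longrightarrow> norm a \<le> 1" and "t \<noteq> 0 \<Longrightarrow> norm b \<le> 1"
  shows "norm (geom_blend t a \<alpha> b \<beta>) \<le> 1"
proof -
  have "norm b powr t * norm a powr (1 - t) \<le> 1" if "t \<noteq> 0" "t \<noteq> 1"
    using that assms by (intro mult_le_one powr_le1) auto
  then show ?thesis using assms by (auto simp: geom_blend_def norm_mult)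
qed

text \<open>In the left half-plane but off the wedge, \<open>norm (Q_exp N z) \<ge> 1\<close> bounds
  \<open>[0/N]\<close>; on the wedge the weight is \<open>1\<close> and only the approximant
  \<open>[1/(N-1)]\<close> enters.\<close>

lemma norm_repaired_map_le_1:
  assumes map: "repaired_map N R_D arg_D" and z: "Re z \<le> 0"
    and fix_le: "norm (pade 1 (N - 1) z) \<le> 1"
  shows "norm (R_D z) \<le> 1"
proof -
  obtain \<theta> arg_raw arg_fix where \<theta>: "wedge_weight N \<theta>" and
    R: "R_D = (\<lambda>z. geom_blend (\<theta> z) (pade 0 N z) (arg_raw z) (pade 1 (N - 1) z) (arg_fix z))"
    using map unfolding repaired_map_def by blast
  have "norm (pade 0 N z) \<le> 1" if "\<theta> z \<noteq> 1"
  proof -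
    have "z \<notin> wedge N" using that \<theta> by (auto simp: wedge_weight_def)
    then have "norm (Q_exp N z) \<ge> 1" using z by (auto simp: wedge_def)
    then show ?thesis by (simp add: pade_0 norm_divide divide_le_eq_1)
  qed
  then show ?thesis using \<theta> fix_le unfolding R wedge_weight_def
    by (intro norm_geom_blend_le_1) auto
qed

lemma taper_bounds:
  assumes "\<omega>\<^sub>c > 0" and "r < 1"
  shows "0 \<le> taper \<omega>\<^sub>c r s \<omega>" and "taper \<omega>\<^sub>c r s \<omega> \<le> 1"
proof -
  have "r * \<omega>\<^sub>c < \<omega>\<^sub>c" using assms by simp
  then show "0 \<le> taper \<omega>\<^sub>c r s \<omega>" "taper \<omega>\<^sub>c r s \<omega> \<le> 1"
    by (auto simp: taper_def Let_def intro!: power_le_one)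
qed

lemma norm_conservative_parent_le_1:
  assumes "Re z \<le> 0"
  shows "norm (conservative_parent M z) \<le> 1"
  using assms norm_pade_1_1_le_1 norm_pade_2_2_le_1 by (cases M) auto

lemma norm_dissipative_parent_le_1:
  assumes "dissipative_parent M R_D arg_D" and "Re z \<le> 0"
  shows "norm (R_D z) \<le> 1"
proof (cases M)
  case MIISO2
  then show ?thesis using assms norm_pade_0_2_le_1 by simp
next
  case MIISO3
  then show ?thesis
    using assms norm_repaired_map_le_1[of 3] norm_pade_1_2_le_1 by simp
next
  case MIISO4
  then show ?thesis
    using assms norm_repaired_map_le_1[of 4] norm_pade_1_3_le_1 by simp
qed

theorem theorem5p3:
  fixes M :: miiso and \<omega>\<^sub>c r :: real and s :: nat and R :: "complex \<Rightarrow> complex"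
  assumes "\<omega>\<^sub>c > 0" and "0 < r" and "r < 1" and "s > 1"
    and "amplification_map M \<omega>\<^sub>c r s R"
  shows "(\<forall>z. Re z \<le> 0 \<longrightarrow> norm (R z) \<le> 1) \<and>
         A_stable R \<and>
         (\<forall>(h::real) (lam::complex) (y :: nat \<Rightarrow> complex).
            h > 0 \<and> Re lam \<le> 0 \<and> (\<forall>n. y (Suc n) = R (of_real h * lam) * y n) \<longrightarrow>
            norm (R (of_real h * lam)) \<le> 1 \<and> (\<forall>n. norm (y (Suc n)) \<le> norm (y n)))"
proof -
  obtain arg_C R_D arg_D where D: "dissipative_parent M R_D arg_D" and
    R: "R = (\<lambda>z. geom_blend (taper \<omega>\<^sub>c r s (norm z))
                   (conservative_parent M z) (arg_C z) (R_D z) (arg_D z))"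
    using assms(5) unfolding amplification_map_def by blast
  have bound: "norm (R z) \<le> 1" if "Re z \<le> 0" for z
    unfolding R using that assms D
    by (intro norm_geom_blend_le_1 taper_bounds norm_conservative_parent_le_1
        norm_dissipative_parent_le_1)
  \<comment> \<open>A positive step keeps \<open>h * lam\<close> in the closed left half-plane,
    whence the independence of \<open>h\<close>.\<close>
  have "norm (R (of_real h * lam)) \<le> 1" if "h > 0" "Re lam \<le> 0" for h lam
    using that by (intro bound) (simp add: mult_nonneg_nonpos)
  then show ?thesis using bound
    by (auto simp: A_stable_def norm_mult intro!: mult_left_le_one_le)
qed

end
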